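(* Let $g:[0,\infty)\to(0,\infty)$ be a positive, (strictly) increasing and differentiable function, let $k>0$ be real, $p\in\mathbb{N}$ (so $p\ge 1$) and $q\in(0,1)$. Let $\lambda,\mu$ be positive real numbers. Then for all real $x,y$ with $0<x<y$, $$\frac{(g(0))^{\lambda}\,k^{-\frac{\lambda}{k}(g(0)-g(x))}\,e^{\frac{\lambda\gamma}{k}(g(0)-g(x))}\,\Gamma_k(g(0))^\lambda}{(g(x))^{\lambda}\,[p]_q^{-\mu(g(0)-g(x))}\,\Gamma_{(p,q)}(g(0))^\mu}\;<\;\frac{\Gamma_k(g(x))^\lambda}{\Gamma_{(p,q)}(g(x))^\mu}\;<\;\frac{(g(y))^{\lambda}\,k^{-\frac{\lambda}{k}(g(y)-g(x))}\,e^{\frac{\lambda\gamma}{k}(g(y)-g(x))}\,\Gamma_k(g(y))^\lambda}{(g(x))^{\lambda}\,[p]_q^{-\mu(g(y)-g(x))}\,\Gamma_{(p,q)}(g(y))^\mu}.$$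
   Context: $\gamma=\lim_{n\to\infty}\left(\sum_{j=1}^{n}\frac1j-\ln n\right)$ is the Euler–Mascheroni constant. For $k>0$ and $t>0$, the $k$-Gamma function is $$\Gamma_k(t)=\int_0^\infty e^{-\frac{x^k}{k}}x^{t-1}\,dx.$$ For $q\in(0,1)$ and real $t>0$, put $[t]_q=\frac{1-q^t}{1-q}$, and for $p\in\mathbb{N}$ put $[p]_q!=[1]_q[2]_q\cdots[p]_q$. The $(p,q)$-Gamma function is, for $t>0$, $$\Gamma_{(p,q)}(t)=\frac{[p]_q^{\,t}\,[p]_q!}{[t]_q[t+1]_q\cdots[t+p]_q}.$$ *)

theory Defs
  imports "HOL-Analysis.Analysis"
begin

text \<open>
  All real powers are written with \<open>powr\<close>, which agrees with the usual power for
  positive bases; every base occurring here is positive for \<open>k > 0\<close>, \<open>t > 0\<close>,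
  \<open>0 < q < 1\<close> and \<open>p \<ge> 1\<close>. The functions below are meaningful only in this range.
\<close>

text \<open>
  Integrating over the open half line avoids \<open>0 powr 0 = 0\<close>. The integrand is nonnegative,
  so the gauge integral coincides with the improper Riemann and the Lebesgue integral.
\<close>

definition k_Gamma :: "real \<Rightarrow> real \<Rightarrow> real" where
  "k_Gamma k t = integral {0<..} (\<lambda>x. exp (- ((x powr k) / k)) * x powr (t - 1))"

definition q_number :: "real \<Rightarrow> real \<Rightarrow> real" where
  "q_number q t = (1 - q powr t) / (1 - q)"

definition q_fact :: "real \<Rightarrow> nat \<Rightarrow> real" where
  "q_fact q p = (\<Prod>j=1..p. q_number q (real j))"

definition pq_Gamma :: "nat \<Rightarrow> real \<Rightarrow> real \<Rightarrow> real" where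
  "pq_Gamma p q t =
     (q_number q (real p) powr t * q_fact q p) / (\<Prod>j=0..p. q_number q (t + real j))"

end

theory Submission
  imports Defs
begin

text \<open>
  Both bounds are instances of the monotonicity of one auxiliary function. Put
  \<open>A u = u * k powr (- u / k) * exp (\<gamma> * u / k) * k_Gamma k u\<close> and
  \<open>B u = pq_Gamma p q u / [p]_q powr u\<close>, and let
  \<open>F u = A u powr \<lambda> / B u powr \<mu>\<close>. The exponents \<open>g 0 - g x\<close> and \<open>g y - g x\<close> in the two
  outer expressions are exactly those which make each of them equal to the middle term times
  \<open>F (g 0) / F (g x)\<close> and \<open>F (g y) / F (g x)\<close> respectively (\<open>bound_conv_normalized_ratio\<close>).
  As \<open>g\<close> is strictly increasing, it is enough that \<open>F\<close> is strictly increasing on the positive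
  reals.

  The substitution \<open>w = x powr k / k\<close> expresses \<open>k_Gamma\<close> through Euler's Gamma function
  (\<open>k_Gamma_conv_Gamma\<close>), and the functional equation then turns \<open>A u\<close> into
  \<open>Gamma (v + 1) * exp (\<gamma> * v)\<close> with \<open>v = u / k\<close>. Its logarithmic derivative is
  \<open>Digamma (v + 1) + \<gamma>\<close>, which is positive for \<open>v > 0\<close>, since \<open>Digamma\<close> is strictly increasing
  with value \<open>- \<gamma>\<close> at 1. So \<open>A\<close> is strictly increasing.

  In \<open>B\<close> the power of \<open>[p]_q\<close> cancels, and what remains is a constant divided by
  \<open>[u]_q * [u + 1]_q * \<dots> * [u + p]_q\<close>, a product of positive strictly increasing factors.
  So \<open>B\<close> is strictly decreasing.
\<close>

text \<open>
  The substitution \<open>u = x powr k / k\<close> maps the positive half line onto itself and turns the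
  integral for \<open>k_Gamma k t\<close> into Euler's integral at \<open>t / k\<close>.
\<close>

lemma k_Gamma_conv_Gamma:
  assumes "0 < k" "0 < t"
  shows "k_Gamma k t = k powr (t / k - 1) * Gamma (t / k)"
proof -
  define s where "s = t / k"
  have s: "0 < s" and t: "t = k * s"
    using assms by (simp_all add: s_def)
  define f :: "real \<Rightarrow> real" where "f = (\<lambda>u. u powr (s - 1) / exp u)"
  define h :: "real \<Rightarrow> real" where "h = (\<lambda>x. x powr k / k)"
  have h_image: "h ` {0<..} = {0<..}"
  proof safe
    fix u :: real assume "0 < u"
    then have "u = h ((k * u) powr (1 / k))"
      using assms by (simp add: h_def powr_powr)
    moreover have "(k * u) powr (1 / k) \<in> {0<..}"
      using \<open>0 < u\<close> assms by simp
    ultimately show "u \<in> h ` {0<..}"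
      by (rule image_eqI)
  qed (use assms in \<open>auto simp: h_def\<close>)
  have h_inj: "inj_on h {0<..}"
    using assms
    by (intro inj_on_inverseI[where g = "\<lambda>u. (k * u) powr (1 / k)"]) (auto simp: h_def powr_powr)
  have h_deriv: "(h has_field_derivative x powr (k - 1)) (at x within {0<..})"
    if "x \<in> {0<..}" for x
    using that assms unfolding h_def by (auto intro!: derivative_eq_intros)
  have "(f has_integral Gamma s) {0..}"
    unfolding f_def by (rule Gamma_integral_real[OF s])
  \<comment> \<open>Euler's integral is over the closed half line, but \<open>h\<close> only reaches the open one.\<close>
  then have f_int: "(f has_integral Gamma s) {0<..}"
    by (subst (asm) has_integral_spike_set_eq[where T = "{0<..}"])
       (auto intro: negligible_subset[of "{0::real}"])
  moreover have "f absolutely_integrable_on {0<..}"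
    using f_int by (intro nonnegative_absolutely_integrable_1) (auto simp: f_def)
  ultimately have "f absolutely_integrable_on h ` {0<..} \<and> integral (h ` {0<..}) f = Gamma s"
    unfolding h_image by (simp add: integral_unique)
  then have "integral {0<..} (\<lambda>x. \<bar>x powr (k - 1)\<bar> * f (h x)) = Gamma s"
    using has_absolute_integral_change_of_variables_1'
            [of "{0<..}" h "\<lambda>x. x powr (k - 1)" f "Gamma s"] h_deriv h_inj
    by auto
  moreover have "exp (- (x powr k / k)) * x powr (t - 1)
                   = k powr (s - 1) * (\<bar>x powr (k - 1)\<bar> * f (h x))" if "x \<in> {0<..}" for x
  proof -
    have "x powr (t - 1) = x powr (k - 1) * (x powr k) powr (s - 1)"
      by (simp add: t powr_powr powr_add[symmetric] algebra_simps)
    also have "(x powr k) powr (s - 1) = k powr (s - 1) * h x powr (s - 1)"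
      using assms by (simp add: h_def powr_divide)
    finally show ?thesis
      by (simp add: f_def h_def exp_minus field_simps)
  qed
  then have "k_Gamma k t = integral {0<..} (\<lambda>x. k powr (s - 1) * (\<bar>x powr (k - 1)\<bar> * f (h x)))"
    unfolding k_Gamma_def by (rule integral_cong)
  ultimately show ?thesis
    by (simp only: integral_mult_right s_def)
qed

lemma k_Gamma_pos:
  assumes "0 < k" "0 < t"
  shows "0 < k_Gamma k t"
  using assms by (simp add: k_Gamma_conv_Gamma)

text \<open>
  The logarithmic derivative \<open>Digamma (w + 1) + \<gamma>\<close> vanishes at \<open>w = 0\<close> and is positive
  afterwards, because \<open>Digamma\<close> is strictly increasing.
\<close>

lemma Gamma_plus1_exp_strict_mono:
  fixes u v :: real
  assumes "0 \<le> u" "u < v"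
  shows "Gamma (u + 1) * exp (euler_mascheroni * u) < Gamma (v + 1) * exp (euler_mascheroni * v)"
proof -
  define L :: "real \<Rightarrow> real" where "L = (\<lambda>w. ln_Gamma (w + 1) + euler_mascheroni * w)"
  have exp_L: "exp (L w) = Gamma (w + 1) * exp (euler_mascheroni * w)" if "0 \<le> w" for w
    using that by (simp add: L_def exp_add Gamma_real_pos_exp)
  have L_deriv: "(L has_real_derivative Digamma (w + 1) + euler_mascheroni) (at w)" if "0 \<le> w" for w
    unfolding L_def using that by (auto intro!: derivative_eq_intros)
  have "continuous_on {u..v} L"
    using assms by (intro continuous_at_imp_continuous_on ballI DERIV_isCont[OF L_deriv]) auto
  then have "L u < L v"
  proof (rule DERIV_pos_imp_increasing_open[OF assms(2), rotated])
    fix w assume "u < w"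
    then show "\<exists>y. (L has_real_derivative y) (at w) \<and> 0 < y"
      using L_deriv[of w] Digamma_real_strict_mono[of 1 "w + 1"] assms by auto
  qed
  then have "exp (L u) < exp (L v)"
    by simp
  then show ?thesis
    using assms by (simp add: exp_L)
qed

text \<open>
  The coefficient of \<open>u\<close> in the exponents is chosen so that the powers of \<open>k\<close> cancel and the
  logarithmic derivative tends to 0 at the origin.
\<close>

definition normalized_k_Gamma :: "real \<Rightarrow> real \<Rightarrow> real" where
  "normalized_k_Gamma k u = u * k powr (- u / k) * exp (euler_mascheroni / k * u) * k_Gamma k u"

lemma normalized_k_Gamma_conv_Gamma:
  assumes "0 < k" "0 < u"
  shows "normalized_k_Gamma k u = Gamma (u / k + 1) * exp (euler_mascheroni * (u / k))"
proof -
  have "Gamma (u / k + 1) = u / k * Gamma (u / k)"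
    using divide_pos_pos[OF assms(2,1)] by (intro Gamma_plus1) (auto elim!: nonpos_Ints_cases')
  then show ?thesis
    using assms
    by (simp add: normalized_k_Gamma_def k_Gamma_conv_Gamma powr_diff powr_minus_divide)
qed

lemma normalized_k_Gamma_pos:
  assumes "0 < k" "0 < u"
  shows "0 < normalized_k_Gamma k u"
  using assms by (simp add: normalized_k_Gamma_conv_Gamma add_pos_pos)

lemma normalized_k_Gamma_strict_mono:
  assumes "0 < k" "0 < u" "u < v"
  shows "normalized_k_Gamma k u < normalized_k_Gamma k v"
  using assms Gamma_plus1_exp_strict_mono[of "u / k" "v / k"]
  by (simp add: normalized_k_Gamma_conv_Gamma divide_strict_right_mono)

lemma q_number_pos:
  assumes "0 < q" "q < 1" "0 < t"
  shows "0 < q_number q t"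
  using assms powr_less_mono'[of q 0 t] by (simp add: q_number_def)

lemma q_number_strict_mono:
  assumes "0 < q" "q < 1" "s < t"
  shows "q_number q s < q_number q t"
  using assms powr_less_mono'[of q s t] by (simp add: q_number_def divide_strict_right_mono)

lemma pq_Gamma_pos:
  assumes "1 \<le> p" "0 < q" "q < 1" "0 < t"
  shows "0 < pq_Gamma p q t"
  unfolding pq_Gamma_def q_fact_def
  using assms q_number_pos[of q "real p"]
  by (intro divide_pos_pos mult_pos_pos prod_pos ballI) (auto intro!: q_number_pos)

text \<open>
  Dividing by the power of \<open>[p]_q\<close> leaves only the product of \<open>q\<close>-numbers in the denominator to
  depend on the argument, and each of its factors increases.
\<close>

lemma pq_Gamma_normalized_strict_antimono:
  assumes "1 \<le> p" "0 < q" "q < 1" "0 < s" "s < t"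
  shows "pq_Gamma p q t / q_number q (real p) powr t < pq_Gamma p q s / q_number q (real p) powr s"
proof -
  have eq: "pq_Gamma p q u / q_number q (real p) powr u
              = q_fact q p / (\<Prod>j=0..p. q_number q (u + real j))" for u
    using assms q_number_pos[of q "real p"] by (simp add: pq_Gamma_def)
  have "0 < q_fact q p"
    using assms by (auto simp: q_fact_def intro!: prod_pos q_number_pos)
  moreover have "(\<Prod>j=0..p. q_number q (s + real j)) < (\<Prod>j=0..p. q_number q (t + real j))"
    using assms by (intro prod_mono_strict[of 0])
      (auto intro!: q_number_pos q_number_strict_mono less_imp_le[OF q_number_pos]
         less_imp_le[OF q_number_strict_mono])
  moreover have "0 < (\<Prod>j=0..p. q_number q (s + real j))"
    using assms by (auto intro!: prod_pos q_number_pos)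
  ultimately show ?thesis
    unfolding eq by (intro divide_strict_left_mono) auto
qed

definition normalized_ratio :: "real \<Rightarrow> nat \<Rightarrow> real \<Rightarrow> real \<Rightarrow> real \<Rightarrow> real \<Rightarrow> real" where
  "normalized_ratio k p q lambda mu u =
     normalized_k_Gamma k u powr lambda / (pq_Gamma p q u / q_number q (real p) powr u) powr mu"

lemma normalized_ratio_pos:
  assumes "0 < k" "1 \<le> p" "0 < q" "q < 1" "0 < u"
  shows "0 < normalized_ratio k p q lambda mu u"
  using assms normalized_k_Gamma_pos[of k u] pq_Gamma_pos[of p q u] q_number_pos[of q "real p"]
  by (simp add: normalized_ratio_def)

lemma normalized_ratio_strict_mono:
  assumes "0 < k" "1 \<le> p" "0 < q" "q < 1" "0 < lambda" "0 < mu" "0 < u" "u < v"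
  shows "normalized_ratio k p q lambda mu u < normalized_ratio k p q lambda mu v"
  unfolding normalized_ratio_def
proof (rule frac_less2)
  have pos: "0 < pq_Gamma p q v / q_number q (real p) powr v"
    using assms pq_Gamma_pos[of p q v] q_number_pos[of q "real p"] by simp
  show "0 < (pq_Gamma p q v / q_number q (real p) powr v) powr mu"
    using less_imp_neq[OF pos] by (simp only: powr_gt_zero)
  show "(pq_Gamma p q v / q_number q (real p) powr v) powr mu
          < (pq_Gamma p q u / q_number q (real p) powr u) powr mu"
    using assms pos by (intro powr_less_mono2 pq_Gamma_normalized_strict_antimono) auto
  show "0 < normalized_k_Gamma k u powr lambda"
    using normalized_k_Gamma_pos[of k u] assms by simp
  show "normalized_k_Gamma k u powr lambda \<le> normalized_k_Gamma k v powr lambda"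
    using assms normalized_k_Gamma_strict_mono[of k u v] normalized_k_Gamma_pos[of k u]
    by (intro powr_mono2) auto
qed

text \<open>
  The powers and exponentials of \<open>a - c\<close> split into a part in \<open>a\<close> and a part in \<open>c\<close>. The
  powers of \<open>k_Gamma k c\<close> and \<open>pq_Gamma p q c\<close>, which are absent on the left, cancel on the
  right.
\<close>

lemma bound_conv_normalized_ratio:
  assumes "0 < k" "1 \<le> p" "0 < q" "q < 1" "0 < a" "0 < c"
  shows "(a powr lambda * k powr (- (lambda / k) * (a - c))
            * exp (lambda * euler_mascheroni / k * (a - c)) * k_Gamma k a powr lambda)
         / (c powr lambda * q_number q (real p) powr (- mu * (a - c)) * pq_Gamma p q a powr mu)
       = normalized_ratio k p q lambda mu a / normalized_ratio k p q lambda mu c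
         * (k_Gamma k c powr lambda / pq_Gamma p q c powr mu)"
proof -
  note pos = k_Gamma_pos[of k a] k_Gamma_pos[of k c] pq_Gamma_pos[of p q a] pq_Gamma_pos[of p q c]
    q_number_pos[of q "real p"]
  have normalized_ratio: "normalized_ratio k p q lambda mu u
      = u powr lambda * k powr (- (lambda / k) * u) * exp (lambda * euler_mascheroni / k * u)
          * k_Gamma k u powr lambda * q_number q (real p) powr (mu * u) / pq_Gamma p q u powr mu"
    if "0 < u" for u
  proof -
    have "exp (euler_mascheroni / k * u) powr lambda = exp (lambda * euler_mascheroni / k * u)"
      by (simp add: powr_def mult_ac)
    then show ?thesis
      using that assms pos k_Gamma_pos[of k u] pq_Gamma_pos[of p q u]
      by (simp add: normalized_ratio_def normalized_k_Gamma_def powr_mult powr_divide powr_powr mult_ac)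
  qed
  have k: "k powr (- (lambda / k) * (a - c))
             = k powr (- (lambda / k) * a) / k powr (- (lambda / k) * c)"
    by (simp only: powr_diff[symmetric] right_diff_distrib)
  have e: "exp (lambda * euler_mascheroni / k * (a - c))
             = exp (lambda * euler_mascheroni / k * a) / exp (lambda * euler_mascheroni / k * c)"
    by (simp only: exp_diff[symmetric] right_diff_distrib)
  have n: "q_number q (real p) powr (- mu * (a - c))
             = q_number q (real p) powr (mu * c) / q_number q (real p) powr (mu * a)"
    unfolding powr_diff[symmetric] by (simp add: algebra_simps)
  show ?thesis
    unfolding k e n normalized_ratio[OF assms(5)] normalized_ratio[OF assms(6)]
    using assms pos by (simp add: field_simps)
qed

theorem theorem2p7:
  fixes g :: "real \<Rightarrow> real" and k q lambda mu :: real and p :: nat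
  assumes g_pos: "\<And>t. 0 \<le> t \<Longrightarrow> 0 < g t"
    and g_incr: "strict_mono_on {0..} g"
    and g_diff: "g differentiable_on {0..}"
    and k_pos: "0 < k"
    and p_ge_1: "1 \<le> p"
    and q_range: "0 < q" "q < 1"
    and lambda_pos: "0 < lambda"
    and mu_pos: "0 < mu"
  shows "\<forall>x y. 0 < x \<and> x < y \<longrightarrow>
     (g 0 powr lambda * k powr (- (lambda / k) * (g 0 - g x))
        * exp (lambda * euler_mascheroni / k * (g 0 - g x)) * k_Gamma k (g 0) powr lambda)
     / (g x powr lambda * q_number q (real p) powr (- mu * (g 0 - g x))
        * pq_Gamma p q (g 0) powr mu)
     < k_Gamma k (g x) powr lambda / pq_Gamma p q (g x) powr mu
   \<and>
     k_Gamma k (g x) powr lambda / pq_Gamma p q (g x) powr mu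
     < (g y powr lambda * k powr (- (lambda / k) * (g y - g x))
        * exp (lambda * euler_mascheroni / k * (g y - g x)) * k_Gamma k (g y) powr lambda)
     / (g x powr lambda * q_number q (real p) powr (- mu * (g y - g x))
        * pq_Gamma p q (g y) powr mu)"
proof (intro allI impI, elim conjE, goal_cases)
  case (1 x y)
  note x = 1(1) and y = 1(2)
  have g_pos': "0 < g 0" "0 < g x" "0 < g y"
    using g_pos x y by auto
  have g_less: "g 0 < g x" "g x < g y"
    using strict_mono_onD[OF g_incr] x y by auto
  let ?F = "normalized_ratio k p q lambda mu"
  let ?R = "k_Gamma k (g x) powr lambda / pq_Gamma p q (g x) powr mu"
  note bound = bound_conv_normalized_ratio[OF k_pos p_ge_1 q_range]
  note mono = normalized_ratio_strict_mono[OF k_pos p_ge_1 q_range lambda_pos mu_pos]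
  have R: "0 < ?R"
    using k_Gamma_pos[OF k_pos g_pos'(2)] pq_Gamma_pos[OF p_ge_1 q_range g_pos'(2)] by simp
  have F: "0 < ?F (g x)"
    using normalized_ratio_pos[OF k_pos p_ge_1 q_range g_pos'(2)] .
  have "?F (g 0) / ?F (g x) < 1" "1 < ?F (g y) / ?F (g x)"
    using F mono[OF g_pos'(1) g_less(1)] mono[OF g_pos'(2) g_less(2)] by simp_all
  then have "?F (g 0) / ?F (g x) * ?R < 1 * ?R \<and> 1 * ?R < ?F (g y) / ?F (g x) * ?R"
    using R by (blast intro: mult_strict_right_mono)
  then show ?case
    unfolding bound[OF g_pos'(1,2)] bound[OF g_pos'(3,2)] mult_1 .
qed

end
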